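(* Let a decision tree with $p$ leaves over $d$ features be given, with distinct thresholds $\theta_{i1}<\dots<\theta_{iK_i}$ on each feature $i\in[d]$, and let $s,s'$ be two splits of the tree on the same feature, $V(s)=V(s')$, where $s'$ has the larger threshold, $C(s)<C(s')$. Define the following sets of pairs $(\bm{x},\bm{z})$ with $\bm{x}=(x_{ij})_{i\in[d],j\in[K_i]}$ real and $\bm{z}\in\mathbb{R}^p$, $\bm{z}\ge 0$: $$\tilde Q^{expset}(s,s')=\Big\{(\bm{x},\bm{z}) : \sum_{l\in \mathrm{below}(s)}z_l\le x_{V(s)C(s)},\ \sum_{l\in \mathrm{above}(s)}z_l\le 1-x_{V(s)C(s)},$$ $$\sum_{l\in \mathrm{below}(s')}z_l\le x_{V(s')C(s')},\ \sum_{l\in \mathrm{above}(s')}z_l\le 1-x_{V(s')C(s')},\ x_{V(s)C(s)}\le x_{V(s')C(s')}\Big\},$$ $$\tilde Q^{misic}(s,s')=\Big\{(\bm{x},\bm{z}) : \sum_{l\in \mathrm{left}(s)}z_l\le x_{V(s)C(s)},\ \sum_{l\in \mathrm{right}(s)}z_l\le 1-x_{V(s)C(s)},$$ $$\sum_{l\in \mathrm{left}(s')}z_l\le x_{V(s')C(s')},\ \sum_{l\in \mathrm{right}(s')}z_l\le 1-x_{V(s')C(s')},\ x_{V(s)C(s)}\le x_{V(s')C(s')}\Big\}.$$ Then $\tilde Q^{expset}(s,s')\subsetneq\tilde Q^{misic}(s,s')$.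
   Context: Notation: $[n]=\{1,\dots,n\}$. A decision tree is a binary tree. Each internal node is a split $s$, given by a condition $w_i\le\theta$ on one feature $i$; the left branch corresponds to $w_i\le\theta$ and the right branch to $w_i\ge\theta$. $\mathrm{left}(s)$ and $\mathrm{right}(s)$ are the (nonempty) sets of leaves lying in the left, respectively right, subtree of $s$. For a split $s$ with condition $w_i\le\theta_{ij}$, $V(s)=i$ is its feature and $C(s)=j$ is the rank of its threshold. $\mathrm{below}(s)$ is the union of $\mathrm{left}(r)$ over all splits $r$ of the tree with $V(r)=V(s)$ and $C(r)\le C(s)$; $\mathrm{above}(s)$ is the union of $\mathrm{right}(r)$ over all splits $r$ of the tree with $V(r)=V(s)$ and $C(r)\ge C(s)$. *)

theory Defs
  imports Complex_Main "HOL-Library.FuncSet"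
begin

(* Leaf carries the index l of its variable z_l.  Split i c L R is the condition w_i <= c on
   feature i; L is the branch w_i <= c and R the branch w_i >= c. *)
datatype dtree =
    Leaf (label: nat)
  | Split (feature: nat) (threshold: real) (left_subtree: dtree) (right_subtree: dtree)

primrec leaf_list :: "dtree \<Rightarrow> nat list" where
  "leaf_list (Leaf l) = [l]"
| "leaf_list (Split i c L R) = leaf_list L @ leaf_list R"

definition leaves :: "dtree \<Rightarrow> nat set" where
  "leaves T = set (leaf_list T)"

(* A split is represented by the subtree rooted at it.  In a tree whose leaf labels are distinct
   (see decision_tree below), different internal nodes have different subtrees, so this loses
   nothing. *)
primrec splits :: "dtree \<Rightarrow> dtree set" where
  "splits (Leaf l) = {}"
| "splits (Split i c L R) = insert (Split i c L R) (splits L \<union> splits R)"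

(* theta i 1 < ... < theta i (K i) are the thresholds on feature i.  Every split uses one of them;
   thresholds that do not occur in T (e.g. coming from other trees of an ensemble) are allowed. *)
definition decision_tree ::
  "nat \<Rightarrow> nat \<Rightarrow> (nat \<Rightarrow> nat) \<Rightarrow> (nat \<Rightarrow> nat \<Rightarrow> real) \<Rightarrow> dtree \<Rightarrow> bool" where
  "decision_tree d p K \<theta> T \<longleftrightarrow>
     distinct (leaf_list T) \<and> leaves T = {1..p} \<and>
     (\<forall>i\<in>{1..d}. strict_mono_on {1..K i} (\<theta> i)) \<and>
     (\<forall>s\<in>splits T. feature s \<in> {1..d} \<and> (\<exists>j\<in>{1..K (feature s)}. threshold s = \<theta> (feature s) j))"

definition V :: "dtree \<Rightarrow> nat" where
  "V s = feature s"

definition C :: "(nat \<Rightarrow> nat) \<Rightarrow> (nat \<Rightarrow> nat \<Rightarrow> real) \<Rightarrow> dtree \<Rightarrow> nat" where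
  "C K \<theta> s = (THE j. j \<in> {1..K (V s)} \<and> threshold s = \<theta> (V s) j)"

definition left :: "dtree \<Rightarrow> nat set" where
  "left s = leaves (left_subtree s)"

definition right :: "dtree \<Rightarrow> nat set" where
  "right s = leaves (right_subtree s)"

definition below :: "(nat \<Rightarrow> nat) \<Rightarrow> (nat \<Rightarrow> nat \<Rightarrow> real) \<Rightarrow> dtree \<Rightarrow> dtree \<Rightarrow> nat set" where
  "below K \<theta> T s = (\<Union>r\<in>{r \<in> splits T. V r = V s \<and> C K \<theta> r \<le> C K \<theta> s}. left r)"

definition above :: "(nat \<Rightarrow> nat) \<Rightarrow> (nat \<Rightarrow> nat \<Rightarrow> real) \<Rightarrow> dtree \<Rightarrow> dtree \<Rightarrow> nat set" where
  "above K \<theta> T s = (\<Union>r\<in>{r \<in> splits T. V r = V s \<and> C K \<theta> r \<ge> C K \<theta> s}. right r)"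

(* The families (x_ij) and the vectors z >= 0 in R^p, as extensional functions. *)
definition x_space :: "nat \<Rightarrow> (nat \<Rightarrow> nat) \<Rightarrow> (nat \<times> nat \<Rightarrow> real) set" where
  "x_space d K = (SIGMA i:{1..d}. {1..K i}) \<rightarrow>\<^sub>E UNIV"

definition z_space :: "nat \<Rightarrow> (nat \<Rightarrow> real) set" where
  "z_space p = {1..p} \<rightarrow>\<^sub>E {0..}"

definition Q_expset ::
  "nat \<Rightarrow> nat \<Rightarrow> (nat \<Rightarrow> nat) \<Rightarrow> (nat \<Rightarrow> nat \<Rightarrow> real) \<Rightarrow> dtree \<Rightarrow> dtree \<Rightarrow> dtree
     \<Rightarrow> ((nat \<times> nat \<Rightarrow> real) \<times> (nat \<Rightarrow> real)) set" where
  "Q_expset d p K \<theta> T s s' =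
     {(x, z). x \<in> x_space d K \<and> z \<in> z_space p \<and>
        (\<Sum>l\<in>below K \<theta> T s. z l) \<le> x (V s, C K \<theta> s) \<and>
        (\<Sum>l\<in>above K \<theta> T s. z l) \<le> 1 - x (V s, C K \<theta> s) \<and>
        (\<Sum>l\<in>below K \<theta> T s'. z l) \<le> x (V s', C K \<theta> s') \<and>
        (\<Sum>l\<in>above K \<theta> T s'. z l) \<le> 1 - x (V s', C K \<theta> s') \<and>
        x (V s, C K \<theta> s) \<le> x (V s', C K \<theta> s')}"

definition Q_misic ::
  "nat \<Rightarrow> nat \<Rightarrow> (nat \<Rightarrow> nat) \<Rightarrow> (nat \<Rightarrow> nat \<Rightarrow> real) \<Rightarrow> dtree \<Rightarrow> dtree
     \<Rightarrow> ((nat \<times> nat \<Rightarrow> real) \<times> (nat \<Rightarrow> real)) set" where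
  "Q_misic d p K \<theta> s s' =
     {(x, z). x \<in> x_space d K \<and> z \<in> z_space p \<and>
        (\<Sum>l\<in>left s. z l) \<le> x (V s, C K \<theta> s) \<and>
        (\<Sum>l\<in>right s. z l) \<le> 1 - x (V s, C K \<theta> s) \<and>
        (\<Sum>l\<in>left s'. z l) \<le> x (V s', C K \<theta> s') \<and>
        (\<Sum>l\<in>right s'. z l) \<le> 1 - x (V s', C K \<theta> s') \<and>
        x (V s, C K \<theta> s) \<le> x (V s', C K \<theta> s')}"

end

theory Submission
  imports Defs
begin

text \<open>
  Inclusion holds because a split is one of those that make up its own \<open>below\<close> and \<open>above\<close>
  sets, so \<open>left s \<subseteq> below s\<close> and \<open>right s \<subseteq> above s\<close>, and \<open>z \<ge> 0\<close>.

  For strictness, the point is that the expset constraints add up leaves of different splits: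
  as \<open>s'\<close> has the larger threshold, \<open>below s'\<close> contains both \<open>left s\<close> and \<open>left s'\<close>, and
  \<open>above s\<close> contains both \<open>right s\<close> and \<open>right s'\<close>. Two different splits of a tree are either
  incomparable or one lies inside a single branch of the other; in every case their left sets
  are disjoint or their right sets are (\<open>left_or_right_disjoint\<close>). Say the left sets are,
  and choose a leaf in each. Then no one of the four misic sets contains both leaves: the left sets
  are disjoint from each other, and each is disjoint from the right set of its own split. Hence
  giving weight \<open>1/2\<close> to both leaves and setting every \<open>x\<close> to \<open>1/2\<close> satisfies the misic
  constraints, while the two leaves together put weight \<open>1\<close> on \<open>below s'\<close>
  (\<open>half_half_point_separates\<close>). The other case is the same with \<open>above s\<close>.
\<close>

section \<open>Leaves of splits\<close>

lemma finite_leaves: "finite (leaves T)"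
  by (simp add: leaves_def)

lemma leaves_nonempty: "leaves T \<noteq> {}"
  by (induction T) (auto simp: leaves_def)

lemma leaves_Split: "leaves (Split i c L R) = leaves L \<union> leaves R"
  by (simp add: leaves_def)

lemma left_right_nonempty: "left s \<noteq> {}" "right s \<noteq> {}"
  by (simp_all add: left_def right_def leaves_nonempty)

lemma splits_left_right:
  assumes "s \<in> splits T"
  shows "leaves s = left s \<union> right s" and "leaves s \<subseteq> leaves T"
  using assms by (induction T) (auto simp: left_def right_def leaves_Split)

lemma left_right_disjoint:
  assumes "distinct (leaf_list T)" "s \<in> splits T"
  shows "left s \<inter> right s = {}"
  using assms by (induction T) (auto simp: left_def right_def leaves_def)

lemma below_subset_leaves: "below K \<theta> T s \<subseteq> leaves T"
  unfolding below_def using splits_left_right by blast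

lemma above_subset_leaves: "above K \<theta> T s \<subseteq> leaves T"
  unfolding above_def using splits_left_right by blast

lemma left_subset_below:
  assumes "r \<in> splits T" "V r = V s" "C K \<theta> r \<le> C K \<theta> s"
  shows "left r \<subseteq> below K \<theta> T s"
  using assms by (auto simp: below_def)

lemma right_subset_above:
  assumes "r \<in> splits T" "V r = V s" "C K \<theta> s \<le> C K \<theta> r"
  shows "right r \<subseteq> above K \<theta> T s"
  using assms by (auto simp: above_def)

text \<open>
  Consider the lowest subtree that contains both splits. If neither split is its root, they lie in
  different branches and share no leaf at all. If one is the root, the other lies in one of its
  branches, and so meets only the left set of the root or only the right set.
\<close>
lemma left_or_right_disjoint:
  assumes "distinct (leaf_list T)" "s \<in> splits T" "s' \<in> splits T" "s \<noteq> s'"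
  shows "left s \<inter> left s' = {} \<or> right s \<inter> right s' = {}"
  using assms
proof (induction T)
  case (Leaf l)
  then show ?case by simp
next
  case (Split i c L R)
  let ?N = "Split i c L R"
  have LR: "leaves L \<inter> leaves R = {}"
    using Split.prems(1) by (auto simp: leaves_def)
  have N: "left ?N = leaves L" "right ?N = leaves R"
    by (simp_all add: left_def right_def)
  have inL: "left r \<subseteq> leaves L \<and> right r \<subseteq> leaves L" if "r \<in> splits L" for r
    using splits_left_right[OF that] by blast
  have inR: "left r \<subseteq> leaves R \<and> right r \<subseteq> leaves R" if "r \<in> splits R" for r
    using splits_left_right[OF that] by blast
  have root: "left ?N \<inter> left r = {} \<or> right ?N \<inter> right r = {}"
    if "r \<in> splits L \<union> splits R" for r
    using that inL[of r] inR[of r] LR N by blast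
  consider "s = ?N" "s' \<in> splits L \<union> splits R" | "s' = ?N" "s \<in> splits L \<union> splits R"
    | "s \<in> splits L" "s' \<in> splits L" | "s \<in> splits R" "s' \<in> splits R"
    | "s \<in> splits L" "s' \<in> splits R" | "s \<in> splits R" "s' \<in> splits L"
    using Split.prems(2-4) by auto
  then show ?case
  proof cases
    case 1
    then show ?thesis using root by blast
  next
    case 2
    then show ?thesis using root by blast
  next
    case 3
    then show ?thesis using Split.IH(1) Split.prems(1,4) by simp
  next
    case 4
    then show ?thesis using Split.IH(2) Split.prems(1,4) by simp
  next
    case 5
    then show ?thesis using inL[of s] inR[of s'] LR by blast
  next
    case 6
    then show ?thesis using inL[of s'] inR[of s] LR by blast
  qed
qed

section \<open>Comparing the two relaxations\<close>

text \<open>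
  Thresholds on one feature are distinct, so the definite description in \<open>C\<close> denotes a rank.
  This makes \<open>(V s, C K \<theta> s)\<close> the index of an actual coordinate of \<open>x\<close>.
\<close>
lemma split_index_in_range:
  assumes "decision_tree d p K \<theta> T" "s \<in> splits T"
  shows "(V s, C K \<theta> s) \<in> (SIGMA i:{1..d}. {1..K i})"
proof -
  have V: "V s \<in> {1..d}"
    and ex: "\<exists>j. j \<in> {1..K (V s)} \<and> threshold s = \<theta> (V s) j"
    using assms unfolding decision_tree_def V_def Bex_def by simp_all
  have "strict_mono_on {1..K (V s)} (\<theta> (V s))"
    using assms(1) V by (auto simp: decision_tree_def)
  then have "inj_on (\<theta> (V s)) {1..K (V s)}"
    by (rule strict_mono_on_imp_inj_on)
  then have "\<exists>!j. j \<in> {1..K (V s)} \<and> threshold s = \<theta> (V s) j"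
    using ex by (metis inj_onD)
  then have "C K \<theta> s \<in> {1..K (V s)}"
    unfolding C_def by (rule theI'[THEN conjunct1])
  then show ?thesis using V by simp
qed

lemma Q_expset_subset_Q_misic:
  assumes "decision_tree d p K \<theta> T" "s \<in> splits T" "s' \<in> splits T"
  shows "Q_expset d p K \<theta> T s s' \<subseteq> Q_misic d p K \<theta> s s'"
proof -
  have leavesT: "leaves T = {1..p}"
    using assms(1) by (simp add: decision_tree_def)
  have le: "sum z (left r) \<le> sum z (below K \<theta> T r)" "sum z (right r) \<le> sum z (above K \<theta> T r)"
    if z: "z \<in> z_space p" and r: "r \<in> splits T" for z :: "nat \<Rightarrow> real" and r
  proof -
    have nonneg: "0 \<le> z l" if "l \<in> leaves T" for l
      using z that leavesT by (auto simp: z_space_def)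
    show "sum z (left r) \<le> sum z (below K \<theta> T r)"
      using below_subset_leaves[of K \<theta> T r] left_subset_below[OF r, of r K \<theta>] nonneg
      by (intro sum_mono2) (auto intro: finite_subset[OF _ finite_leaves])
    show "sum z (right r) \<le> sum z (above K \<theta> T r)"
      using above_subset_leaves[of K \<theta> T r] right_subset_above[OF r, of r K \<theta>] nonneg
      by (intro sum_mono2) (auto intro: finite_subset[OF _ finite_leaves])
  qed
  show ?thesis
  proof (rule subrelI)
    fix x z assume xz: "(x, z) \<in> Q_expset d p K \<theta> T s s'"
    then have "z \<in> z_space p" by (simp add: Q_expset_def)
    from le[OF this assms(2)] le[OF this assms(3)] xz
    show "(x, z) \<in> Q_misic d p K \<theta> s s'"
      by (simp add: Q_expset_def Q_misic_def)
  qed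
qed

text \<open>
  The separating point: \<open>x\<close> is constantly \<open>1/2\<close> and \<open>z\<close> is \<open>1/2\<close> on \<open>a\<close> and \<open>b\<close> only. With
  \<open>x = 1/2\<close> every upper bound on a sum of \<open>z\<close> is \<open>1/2\<close>, so a constraint holds as long as its set
  misses one of the two leaves and fails once it contains both.
\<close>
lemma half_half_point_separates:
  assumes tree: "decision_tree d p K \<theta> T" and s: "s \<in> splits T" and s': "s' \<in> splits T"
    and "a \<noteq> b"
    and misic: "\<not> {a, b} \<subseteq> left s" "\<not> {a, b} \<subseteq> right s" "\<not> {a, b} \<subseteq> left s'" "\<not> {a, b} \<subseteq> right s'"
    and expset: "{a, b} \<subseteq> below K \<theta> T s' \<or> {a, b} \<subseteq> above K \<theta> T s"
  shows "\<not> Q_misic d p K \<theta> s s' \<subseteq> Q_expset d p K \<theta> T s s'"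
proof -
  define x :: "nat \<times> nat \<Rightarrow> real"
    where "x = restrict (\<lambda>_. 1/2) (SIGMA i:{1..d}. {1..K i})"
  define z :: "nat \<Rightarrow> real"
    where "z = restrict (\<lambda>l. if l \<in> {a, b} then 1/2 else 0) {1..p}"
  have leavesT: "leaves T = {1..p}"
    using tree by (simp add: decision_tree_def)
  have x_half: "x (V r, C K \<theta> r) = 1/2" if "r \<in> splits T" for r
    unfolding x_def using split_index_in_range[OF tree that] by simp
  have x_in: "x \<in> x_space d K"
    by (simp add: x_def x_space_def)
  have z_in: "z \<in> z_space p"
    by (auto simp: z_def z_space_def)
  have sum_z: "sum z A = card (A \<inter> {a, b}) / 2" if "A \<subseteq> leaves T" for A
  proof -
    have "finite A" using that finite_leaves finite_subset by blast
    have "sum z A = (\<Sum>l\<in>A. if l \<in> {a, b} then 1/2 else 0)"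
      using that leavesT by (intro sum.cong) (auto simp: z_def)
    also have "\<dots> = (\<Sum>l\<in>A \<inter> {a, b}. 1/2)"
      using \<open>finite A\<close> by (rule sum.inter_restrict[symmetric])
    also have "\<dots> = card (A \<inter> {a, b}) / 2" by simp
    finally show ?thesis .
  qed
  have sum_le: "sum z A \<le> 1/2" if "A \<subseteq> leaves T" "\<not> {a, b} \<subseteq> A" for A
  proof -
    have "A \<inter> {a, b} \<subseteq> {a} \<or> A \<inter> {a, b} \<subseteq> {b}" using that(2) by blast
    then have "card (A \<inter> {a, b}) \<le> 1"
      using card_mono[of "{a}" "A \<inter> {a, b}"] card_mono[of "{b}" "A \<inter> {a, b}"] by auto
    then show ?thesis by (simp add: sum_z[OF that(1)])
  qed
  have sum_eq: "sum z A = 1" if "A \<subseteq> leaves T" "{a, b} \<subseteq> A" for A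
  proof -
    have "A \<inter> {a, b} = {a, b}" using that(2) by blast
    then show ?thesis using sum_z[OF that(1)] \<open>a \<noteq> b\<close> by simp
  qed
  have sub: "left r \<subseteq> leaves T" "right r \<subseteq> leaves T" if "r \<in> splits T" for r
    using splits_left_right[OF that] by blast+
  have "(x, z) \<in> Q_misic d p K \<theta> s s'"
    using x_in z_in x_half[OF s] x_half[OF s']
      sum_le[OF sub(1)[OF s] misic(1)] sum_le[OF sub(2)[OF s] misic(2)]
      sum_le[OF sub(1)[OF s'] misic(3)] sum_le[OF sub(2)[OF s'] misic(4)]
    by (simp add: Q_misic_def)
  moreover have "sum z (below K \<theta> T s') = 1 \<or> sum z (above K \<theta> T s) = 1"
    using expset sum_eq[OF below_subset_leaves] sum_eq[OF above_subset_leaves] by metis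
  then have "(x, z) \<notin> Q_expset d p K \<theta> T s s'"
    using x_half[OF s] x_half[OF s'] by (auto simp: Q_expset_def)
  ultimately show ?thesis by blast
qed

theorem proposition3:
  fixes d p :: nat and K :: "nat \<Rightarrow> nat" and \<theta> :: "nat \<Rightarrow> nat \<Rightarrow> real" and T s s' :: dtree
  assumes "decision_tree d p K \<theta> T"
    and "s \<in> splits T" and "s' \<in> splits T"
    and "V s = V s'" and "C K \<theta> s < C K \<theta> s'"
  shows "Q_expset d p K \<theta> T s s' \<subset> Q_misic d p K \<theta> s s'"
proof -
  have dist: "distinct (leaf_list T)"
    using assms(1) by (simp add: decision_tree_def)
  have disj: "left s \<inter> right s = {}" "left s' \<inter> right s' = {}"
    using left_right_disjoint[OF dist] assms(2,3) by blast+
  have "s \<noteq> s'" using assms(5) by auto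
  then consider "left s \<inter> left s' = {}" | "right s \<inter> right s' = {}"
    using left_or_right_disjoint[OF dist assms(2,3)] by blast
  then have "\<not> Q_misic d p K \<theta> s s' \<subseteq> Q_expset d p K \<theta> T s s'"
  proof cases
    case 1
    obtain a b where ab: "a \<in> left s" "b \<in> left s'"
      using left_right_nonempty by blast
    have "{a, b} \<subseteq> below K \<theta> T s'"
      using ab left_subset_below[OF assms(2,4)] left_subset_below[OF assms(3) refl] assms(5)
      by (simp add: subset_iff)
    then show ?thesis
      using 1 ab disj by (intro half_half_point_separates[OF assms(1-3), of a b]) auto
  next
    case 2
    obtain a b where ab: "a \<in> right s" "b \<in> right s'"
      using left_right_nonempty by blast
    have "{a, b} \<subseteq> above K \<theta> T s"
      using ab right_subset_above[OF assms(2) refl] right_subset_above[OF assms(3) assms(4)[symmetric]]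
        assms(5)
      by (simp add: subset_iff)
    then show ?thesis
      using 2 ab disj by (intro half_half_point_separates[OF assms(1-3), of a b]) auto
  qed
  then show ?thesis
    using Q_expset_subset_Q_misic[OF assms(1-3)] by blast
qed

end
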